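(* Let $a,b,m\in\mathbb{Z}$ with $a\ge 2$, $m>1$, $\gcd(b,m)=1$, and $b>-(a-1)m$. Let $S=S_{a,b}(m)$, let $n$ be the smallest positive integer such that $A_n\ge m$, and write $A_n=qm+r$, where $q\in\mathbb{N}\setminus\{0\}$ and $0\le r\le m-1$. If \[ b\ge -(a-1)m+\left\lceil\frac{r-1}{q}\right\rceil, \] then $\operatorname{msg}(S)=\{s_0,\ldots,s_{n-1}\}$ and $\operatorname{e}(S)=n$.
   Context: $\mathbb{N}=\{0,1,2,\dots\}$. A numerical semigroup is a submonoid of $(\mathbb{N},+)$ with finite complement in $\mathbb{N}$. Every numerical semigroup $S$ has a unique minimal system of generators, which is finite, denoted $\operatorname{msg}(S)$; its cardinality is the embedding dimension $\operatorname{e}(S)$. Let $T_{a,b}(z)=az+b$, with $T_{a,b}^i$ its $i$-fold composition ($T_{a,b}^0$ the identity), and let $S_{a,b}(m)=\langle T_{a,b}^i(m)\mid i\ge 0\rangle$ be the submonoid of $\mathbb{N}$ generated by the orbit of $m$; under the stated hypotheses it is a numerical semigroup of multiplicity (smallest positive element) $m$. Set $d=(a-1)m+b$, $A_i=(a^i-1)/(a-1)$ for $i\ge 0$, and $s_i=T_{a,b}^i(m)=m+A_id$ for $i\ge 0$. *)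

theory Defs
  imports Complex_Main
begin

definition nat_submonoid :: "nat set \<Rightarrow> bool" where
  "nat_submonoid M \<longleftrightarrow> 0 \<in> M \<and> (\<forall>x\<in>M. \<forall>y\<in>M. x + y \<in> M)"

definition minimal_generators :: "nat set \<Rightarrow> nat set \<Rightarrow> bool" where
  "minimal_generators S X \<longleftrightarrow>
     nat_submonoid hull X = S \<and> (\<forall>Y. Y \<subset> X \<longrightarrow> nat_submonoid hull Y \<noteq> S)"

definition msg :: "nat set \<Rightarrow> nat set" where
  "msg S = (THE X. minimal_generators S X)"

definition embedding_dimension :: "nat set \<Rightarrow> nat" where
  "embedding_dimension S = card (msg S)"

text \<open>The description operator in \<^const>\<open>msg\<close> is justified: every submonoid of the naturals,
  in particular every numerical semigroup, has exactly one minimal system of generators.\<close>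

lemma ex1_minimal_generators:
  assumes "nat_submonoid S"
  shows "\<exists>!X. minimal_generators S X"
proof -
  define I where "I = {x \<in> S. x \<noteq> 0 \<and> (\<forall>y\<in>S. \<forall>z\<in>S. x = y + z \<longrightarrow> y = 0 \<or> z = 0)}"
  have hull_closed: "nat_submonoid (nat_submonoid hull X)" for X
    by (auto simp: nat_submonoid_def hull_def)
  have generates: "nat_submonoid hull I = S"
  proof
    show "nat_submonoid hull I \<subseteq> S"
      using assms by (intro hull_minimal) (auto simp: I_def)
    have "x \<in> S \<longrightarrow> x \<in> nat_submonoid hull I" for x
    proof (induction x rule: less_induct)
      case (less x)
      show ?case
      proof (cases "x = 0 \<or> x \<in> I")
        case True
        moreover have "0 \<in> nat_submonoid hull I"
          using hull_closed[of I] unfolding nat_submonoid_def[of "nat_submonoid hull I"] by blast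
        ultimately show ?thesis
          using hull_subset[of I nat_submonoid] by auto
      next
        case False
        show ?thesis
        proof
          assume "x \<in> S"
          have add: "y + z \<in> nat_submonoid hull I"
            if "y \<in> nat_submonoid hull I" "z \<in> nat_submonoid hull I" for y z
            using hull_closed[of I] that
            unfolding nat_submonoid_def[of "nat_submonoid hull I"] by blast
          from \<open>x \<in> S\<close> and False obtain y z where "y \<in> S" "z \<in> S" "x = y + z" "y \<noteq> 0" "z \<noteq> 0"
            by (auto simp: I_def)
          with less add show "x \<in> nat_submonoid hull I" by simp
        qed
      qed
    qed
    then show "S \<subseteq> nat_submonoid hull I" by blast
  qed
  have contained: "I \<subseteq> X" if X: "nat_submonoid hull X = S" for X
  proof
    fix x assume x: "x \<in> I"
    show "x \<in> X"
    proof (rule ccontr)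
      assume "x \<notin> X"
      have "nat_submonoid (S - {x})"
        using assms x by (fastforce simp: nat_submonoid_def I_def)
      moreover have "X \<subseteq> S - {x}"
        using X hull_subset[of X nat_submonoid] \<open>x \<notin> X\<close> by auto
      ultimately have "nat_submonoid hull X \<subseteq> S - {x}"
        by (intro hull_minimal)
      with X x show False by (auto simp: I_def)
    qed
  qed
  show ?thesis
    unfolding minimal_generators_def using generates contained
    by (metis psubset_eq subset_not_subset_eq)
qed

definition affine_map :: "int \<Rightarrow> int \<Rightarrow> int \<Rightarrow> int" where
  "affine_map a b z = a * z + b"

definition orbit_point :: "int \<Rightarrow> int \<Rightarrow> int \<Rightarrow> nat \<Rightarrow> int" where
  "orbit_point a b m i = (affine_map a b ^^ i) m"

text \<open>The orbit lives in the integers because \<open>b\<close> may be negative, while the semigroup is a set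
  of naturals. If \<open>m \<ge> 0\<close> and \<open>b \<ge> -(a - 1) * m\<close> with \<open>a \<ge> 1\<close>, every orbit point
  is nonnegative, so the comprehension below then loses none of them.\<close>

definition orbit_semigroup :: "int \<Rightarrow> int \<Rightarrow> int \<Rightarrow> nat set" where
  "orbit_semigroup a b m = nat_submonoid hull {x. \<exists>i. int x = orbit_point a b m i}"

text \<open>The integer division is exact, since \<open>a - 1\<close> divides \<open>a ^ i - 1\<close>.\<close>

definition repunit :: "int \<Rightarrow> nat \<Rightarrow> int" where
  "repunit a i = (a ^ i - 1) div (a - 1)"

end

theory Submission
  imports Defs
begin

text \<open>
  With \<open>d = (a - 1) * m + b > 0\<close> the orbit is \<open>s\<^sub>i = m + A\<^sub>i * d\<close>, where \<open>A\<^sub>i\<close> is the repunit.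

  Generation: from \<open>A\<^bsub>n+j\<^esub> = a^j * A\<^sub>n + A\<^sub>j\<close> and \<open>A\<^sub>n = q * m + r\<close> one gets, if \<open>r > 0\<close>,
  \<open>s\<^bsub>n+j\<^esub> = s\<^bsub>j+1\<^esub> + a^j * (r - 1) * s\<^sub>1 + a^j * (q * d - (r - 1)) * s\<^sub>0\<close>,
  and \<open>s\<^bsub>n+j\<^esub> = s\<^sub>j + a^j * q * d * s\<^sub>0\<close> if \<open>r = 0\<close>. The hypothesis on \<open>b\<close> says exactly that
  \<open>q * d \<ge> r - 1\<close>.

  Minimality: a sum of two nonzero elements of the semigroup has the form \<open>C * m + V * d\<close> with
  \<open>C \<ge> 2\<close> and \<open>V \<ge> 0\<close>. If it equals \<open>m + A\<^sub>j * d\<close>, then \<open>m\<close>, being coprime to \<open>d\<close>, divides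
  \<open>A\<^sub>j - V > 0\<close>, so \<open>A\<^sub>j \<ge> m\<close> and \<open>j \<ge> n\<close>.
\<close>

lemma nat_submonoid_hull: "nat_submonoid (nat_submonoid hull X)"
  by (auto simp: nat_submonoid_def hull_def)

lemma nat_submonoid_add: "nat_submonoid M \<Longrightarrow> x \<in> M \<Longrightarrow> y \<in> M \<Longrightarrow> x + y \<in> M"
  by (simp add: nat_submonoid_def)

lemma nat_submonoid_mult: "nat_submonoid M \<Longrightarrow> x \<in> M \<Longrightarrow> k * x \<in> M"
  by (induction k) (auto simp: nat_submonoid_def)

text \<open>An irreducible \<open>x\<close> can be deleted from \<open>S\<close> without losing
  closure under addition. A subset of \<open>G\<close> that misses \<open>x\<close> therefore
  generates only a part of \<open>S - {x}\<close>.\<close>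

lemma msg_eqI:
  assumes hull: "nat_submonoid hull G = S" and "0 \<notin> G"
    and irreducible: "\<And>y z. y + z \<in> G \<Longrightarrow> y \<in> S \<Longrightarrow> z \<in> S \<Longrightarrow> y = 0 \<or> z = 0"
  shows "msg S = G"
proof -
  have S: "nat_submonoid S"
    using nat_submonoid_hull[of G] hull by simp
  have "nat_submonoid hull Y \<noteq> S" if "Y \<subset> G" for Y
  proof -
    from that obtain x where x: "x \<in> G" "x \<notin> Y" by blast
    have "nat_submonoid (S - {x})"
      unfolding nat_submonoid_def
    proof (intro conjI ballI)
      show "0 \<in> S - {x}"
        using S x \<open>0 \<notin> G\<close> by (cases "x = 0") (auto simp: nat_submonoid_def)
      fix y z assume yz: "y \<in> S - {x}" "z \<in> S - {x}"
      then have "y + z \<noteq> x"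
        using irreducible[of y z] x by auto
      with yz show "y + z \<in> S - {x}"
        using nat_submonoid_add[OF S] by auto
    qed
    moreover have "Y \<subseteq> S - {x}"
      using that x hull hull_subset[of G nat_submonoid] by auto
    ultimately have "nat_submonoid hull Y \<subseteq> S - {x}"
      by (intro hull_minimal)
    moreover have "x \<in> S"
      using x hull hull_subset[of G nat_submonoid] by auto
    ultimately show ?thesis by auto
  qed
  then have "minimal_generators S G"
    using hull by (simp add: minimal_generators_def)
  then show ?thesis
    unfolding msg_def using ex1_minimal_generators[OF S] by (intro the1_equality)
qed

lemma repunit_0 [simp]: "repunit a 0 = 0"
  by (simp add: repunit_def)

lemma repunit_mult_diff:
  assumes "a \<noteq> 1"
  shows "(a - 1) * repunit a i = a ^ i - 1"
  using assms by (simp add: repunit_def power_diff_1_eq)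

text \<open>Multiplying by \<open>a - 1\<close> turns the integer divisions into powers of
  \<open>a\<close>; this factor is nonzero and cancels at the end.\<close>

lemma repunit_add:
  assumes "a \<noteq> 1"
  shows "repunit a (i + j) = a ^ j * repunit a i + repunit a j"
proof -
  have "(a - 1) * (a ^ j * repunit a i + repunit a j)
      = a ^ j * ((a - 1) * repunit a i) + (a - 1) * repunit a j"
    by (simp add: algebra_simps)
  also have "\<dots> = (a - 1) * repunit a (i + j)"
    by (simp only: repunit_mult_diff[OF assms] power_add) (simp add: algebra_simps)
  finally show ?thesis
    using assms by simp
qed

lemma repunit_1 [simp]: "a \<noteq> 1 \<Longrightarrow> repunit a (Suc 0) = 1"
  by (simp add: repunit_def)

lemma repunit_Suc: "a \<noteq> 1 \<Longrightarrow> repunit a (Suc i) = a * repunit a i + 1"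
  using repunit_add[of a i 1] by simp

text \<open>This crude bound supplies both the nonnegativity of the repunits and an index at which
  they reach \<open>m\<close>.\<close>

lemma repunit_ge:
  assumes "a \<ge> 2"
  shows "int i \<le> repunit a i"
proof (induction i)
  case (Suc i)
  then have "1 * repunit a i \<le> a * repunit a i"
    using assms by (intro mult_right_mono) auto
  with Suc show ?case
    using assms by (simp add: repunit_Suc)
qed simp

lemma strict_mono_repunit:
  assumes "a \<ge> 2"
  shows "strict_mono (repunit a)"
proof (rule strict_mono_Suc_iff[THEN iffD2], rule allI)
  fix i
  have "1 * repunit a i \<le> a * repunit a i"
    using assms repunit_ge[OF assms, of i] by (intro mult_right_mono) auto
  then show "repunit a i < repunit a (Suc i)"
    using assms by (simp add: repunit_Suc)
qed

lemma orbit_point_eq: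
  assumes "a \<noteq> 1"
  shows "orbit_point a b m i = m + repunit a i * ((a - 1) * m + b)"
proof (induction i)
  case (Suc i)
  have "orbit_point a b m (Suc i) = a * orbit_point a b m i + b"
    by (simp add: orbit_point_def affine_map_def)
  then show ?case
    unfolding Suc using assms by (simp add: repunit_Suc algebra_simps)
qed (simp add: orbit_point_def)

theorem corollary3p2:
  fixes a b m r :: int and n q :: nat and S :: "nat set"
  assumes "a \<ge> 2" and "m > 1" and "gcd b m = 1" and "b > - ((a - 1) * m)"
    and "S = orbit_semigroup a b m"
    and "n = (LEAST k. 0 < k \<and> repunit a k \<ge> m)"
    and "repunit a n = int q * m + r" and "q \<noteq> 0" and "0 \<le> r" and "r \<le> m - 1"
    and "b \<ge> - ((a - 1) * m) + \<lceil>(real_of_int r - 1) / real q\<rceil>"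
  shows "int ` msg S = orbit_point a b m ` {0..<n} \<and> embedding_dimension S = n"
proof -

  \<comment> \<open>The orbit as positive naturals\<close>
  define d where "d = (a - 1) * m + b"
  define s where "s i = nat (orbit_point a b m i)" for i
  have a: "a \<noteq> 1" and d: "d > 0"
    using assms by (auto simp: d_def)
  have A_nonneg: "repunit a i \<ge> 0" for i
    using repunit_ge[OF \<open>a \<ge> 2\<close>, of i] by linarith
  have orbit: "orbit_point a b m i = m + repunit a i * d" for i
    by (simp add: orbit_point_eq[OF a] d_def)
  have orbit_pos: "orbit_point a b m i > 0" for i
    using A_nonneg[of i] d \<open>m > 1\<close> by (simp add: orbit add_pos_nonneg)
  then have int_s: "int (s i) = orbit_point a b m i" for i
    by (simp add: s_def less_imp_le)
  have int_s': "int (s i) = m + repunit a i * d" for i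
    by (simp add: int_s orbit)
  have s_pos: "s i > 0" for i
    using orbit_pos[of i] by (simp add: s_def)
  \<comment> \<open>Injectivity turns the description of the generators into the count
    \<open>n\<close>.\<close>
  have inj_s: "inj s"
  proof (rule injI)
    fix i j assume "s i = s j"
    then have "m + repunit a i * d = m + repunit a j * d"
      by (metis int_s')
    then show "i = j"
      using d strict_mono_eq[OF strict_mono_repunit[OF \<open>a \<ge> 2\<close>]] by simp
  qed
  have S: "S = nat_submonoid hull (range s)"
  proof -
    have "{x. \<exists>i. int x = orbit_point a b m i} = range s"
      by (auto simp flip: int_s)
    then show ?thesis
      using assms(5) by (simp add: orbit_semigroup_def)
  qed

  \<comment> \<open>The index \<open>n\<close> and the bound on \<open>r\<close>\<close>
  have "repunit a (nat m) \<ge> m"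
    using repunit_ge[OF \<open>a \<ge> 2\<close>, of "nat m"] \<open>m > 1\<close> by simp
  \<comment> \<open>The witness \<open>nat m\<close> shows that the \<open>LEAST\<close> ranges over
    a nonempty set.\<close>
  then have n: "0 < n \<and> repunit a n \<ge> m"
    using LeastI[of "\<lambda>k. 0 < k \<and> repunit a k \<ge> m" "nat m"] assms(6) \<open>m > 1\<close> by simp
  \<comment> \<open>Minimality of \<open>n\<close> says nothing about index 0, where the repunit is
    0.\<close>
  have A_less: "repunit a j < m" if "j < n" for j
    using not_less_Least[of j "\<lambda>k. 0 < k \<and> repunit a k \<ge> m"] that assms(6) \<open>m > 1\<close>
    by (cases "j = 0") auto
  have "n \<noteq> 1"
    using n \<open>m > 1\<close> a by auto
  with n have "n \<ge> 2" by linarith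
  have qd: "r - 1 \<le> int q * d"
  proof -
    have "\<lceil>(real_of_int r - 1) / real q\<rceil> \<le> d"
      using assms(11) by (simp add: d_def)
    then have "(real_of_int r - 1) / real q \<le> real_of_int d"
      by (simp add: ceiling_le_iff)
    then have "real_of_int r - 1 \<le> real_of_int d * real q"
      using \<open>q \<noteq> 0\<close> by (simp add: pos_divide_le_eq)
    then have "real_of_int (r - 1) \<le> real_of_int (int q * d)"
      by (simp add: mult.commute)
    then show ?thesis by (simp only: of_int_le_iff)
  qed

  \<comment> \<open>Generation by the first \<open>n\<close> orbit points\<close>
  define G where "G = s ` {0..<n}"
  let ?H = "nat_submonoid hull G"
  note H_add = nat_submonoid_add[OF nat_submonoid_hull]
  note H_mult = nat_submonoid_mult[OF nat_submonoid_hull]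
  have s_H: "s i \<in> ?H" for i
  proof (induction i rule: less_induct)
    case (less i)
    show ?case
    proof (cases "i < n")
      case True
      then show ?thesis
        using hull_subset[of G nat_submonoid] by (auto simp: G_def)
    next
      case False
      then obtain j where i: "i = n + j"
        using le_Suc_ex[of n i] by auto
      have A: "repunit a i = a ^ j * (int q * m + r) + repunit a j"
        using repunit_add[OF a, of n j] assms(7) i by simp
      have aj: "a ^ j \<ge> 0"
        using \<open>a \<ge> 2\<close> by simp
      \<comment> \<open>Since \<open>n \<ge> 2\<close>, the indices 0, 1 and later
        \<open>j + 1\<close> all lie below \<open>i = n + j\<close>, so the induction hypothesis
        covers them.\<close>
      have H01: "s 0 \<in> ?H" "s 1 \<in> ?H"
        using less i \<open>n \<ge> 2\<close> by auto
      show ?thesis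
      \<comment> \<open>For \<open>r = 0\<close> the multiplier \<open>r - 1\<close> of
        \<open>s 1\<close> would be negative, so another decomposition is used.\<close>
      proof (cases "r = 0")
        case True
        define u where "u = nat (a ^ j * int q * d)"
        have u: "int u = a ^ j * int q * d"
          using aj d by (simp add: u_def)
        have "int (s i) = int (s j + u * s 0)"
          unfolding of_nat_add of_nat_mult u int_s' A True by (simp add: algebra_simps)
        then have "s i = s j + u * s 0"
          by (simp only: of_nat_eq_iff)
        moreover have "s j \<in> ?H"
          using less i \<open>n \<ge> 2\<close> by simp
        ultimately show ?thesis
          using H_add H_mult H01 by simp
      next
        case False
        \<comment> \<open>Both \<open>nat\<close> conversions are lossless: \<open>r \<ge> 1\<close>
          in this case, and \<open>qd\<close> handles the second.\<close>
        define u where "u = nat (a ^ j * (r - 1))"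
        define v where "v = nat (a ^ j * (int q * d - (r - 1)))"
        have u: "int u = a ^ j * (r - 1)"
          using aj False \<open>0 \<le> r\<close> by (simp add: u_def)
        have v: "int v = a ^ j * (int q * d - (r - 1))"
          using aj qd by (simp add: v_def)
        have A1: "repunit a (j + 1) = a ^ j + repunit a j"
          using repunit_add[OF a, of 1 j] a by (simp add: add.commute)
        have "int (s i) = int (s (j + 1) + u * s 1 + v * s 0)"
          unfolding of_nat_add of_nat_mult u v int_s' A A1 using a
          by (simp add: algebra_simps)
        then have "s i = s (j + 1) + u * s 1 + v * s 0"
          by (simp only: of_nat_eq_iff)
        moreover have "s (j + 1) \<in> ?H"
          using less i \<open>n \<ge> 2\<close> by simp
        ultimately show ?thesis
          using H_add H_mult H01 by simp
      qed
    qed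
  qed
  have hull_G: "?H = S"
  proof
    show "?H \<subseteq> S"
      unfolding S G_def by (intro hull_mono) auto
    show "S \<subseteq> ?H"
      unfolding S using s_H by (intro hull_minimal nat_submonoid_hull) auto
  qed

  \<comment> \<open>Irreducibility of the generators\<close>
  define T where "T = {x. x = 0 \<or> (\<exists>C V. C \<ge> 1 \<and> V \<ge> 0 \<and> int x = C * m + V * d)}"
  have "nat_submonoid T"
    unfolding nat_submonoid_def
  proof (intro conjI ballI)
    show "0 \<in> T" by (simp add: T_def)
    fix x y assume xy: "x \<in> T" "y \<in> T"
    show "x + y \<in> T"
    proof (cases "x = 0 \<or> y = 0")
      case False
      with xy obtain C V C' V' where
        "C \<ge> 1" "V \<ge> 0" "int x = C * m + V * d" "C' \<ge> 1" "V' \<ge> 0" "int y = C' * m + V' * d"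
        by (auto simp: T_def)
      then have "C + C' \<ge> 1" "V + V' \<ge> 0" "int (x + y) = (C + C') * m + (V + V') * d"
        by (auto simp: algebra_simps)
      then show ?thesis unfolding T_def by blast
    qed (use xy in auto)
  qed
  moreover have "range s \<subseteq> T"
  proof (rule image_subsetI)
    fix i
    have "int (s i) = 1 * m + repunit a i * d"
      by (simp add: int_s')
    then show "s i \<in> T"
      unfolding T_def using A_nonneg[of i] by fastforce
  qed
  ultimately have S_T: "S \<subseteq> T"
    unfolding S by (intro hull_minimal)

  have coprime: "coprime m d"
  proof -
    have "gcd m d = gcd m b"
      using gcd_add_mult[of m "a - 1" b] by (simp add: d_def)
    then show ?thesis
      using \<open>gcd b m = 1\<close> by (simp add: coprime_iff_gcd_eq_1 gcd.commute)
  qed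
  have irreducible: "y = 0 \<or> z = 0" if "y + z \<in> G" "y \<in> S" "z \<in> S" for y z
  proof (rule ccontr)
    assume "\<not> (y = 0 \<or> z = 0)"
    with that S_T obtain C V C' V' where
      yz: "C \<ge> 1" "V \<ge> 0" "int y = C * m + V * d" "C' \<ge> 1" "V' \<ge> 0" "int z = C' * m + V' * d"
      unfolding T_def by blast
    from that obtain j where j: "j < n" "y + z = s j"
      by (auto simp: G_def)
    define W where "W = repunit a j - (V + V')"
    have "int y + int z = m + repunit a j * d"
      using j int_s'[of j] by (simp flip: of_nat_add)
    \<comment> \<open>The \<open>- 1\<close> is the single \<open>m\<close> in \<open>s j\<close>;
      two nonzero summands give \<open>C + C' \<ge> 2\<close>, so the right side stays
      positive.\<close>
    then have eq: "W * d = (C + C' - 1) * m"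
      using yz by (simp add: W_def algebra_simps)
    moreover have "(C + C' - 1) * m > 0"
      using yz \<open>m > 1\<close> by simp
    ultimately have "W > 0"
      using d by (metis zero_less_mult_pos2)
    moreover have "m dvd W"
      using eq coprime by (metis coprime_dvd_mult_left_iff dvd_triv_right)
    ultimately have "m \<le> W"
      by (rule zdvd_imp_le[rotated])
    then show False
      using A_less[OF j(1)] yz by (simp add: W_def)
  qed
  have "0 \<notin> G"
    unfolding G_def using s_pos by (metis imageE less_irrefl)
  then have msg: "msg S = G"
    using msg_eqI hull_G irreducible by blast
  moreover have "card G = n"
    unfolding G_def using inj_s by (simp add: card_image inj_on_subset)
  moreover have "int ` G = orbit_point a b m ` {0..<n}"
    by (simp add: G_def image_image int_s)
  ultimately show ?thesis
    by (simp add: embedding_dimension_def)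
qed

end
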